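(* The complete list of permutation polynomials of $\mathbb{F}_{3^2}$ of the form \[ f(x)=x^6+a_5x^5+a_3x^3+a_2x^2+a_1x \qquad (a_1,a_2,a_3,a_5\in\mathbb{F}_{3^2}) \] with $a_5\neq 0$ is given by \begin{itemize} \item $x^6+ax^5+a^3x^3+2a^4x^2+2a^5x$, with $a\neq 0$; \item $x^6+ax^5+\varphi a^3x^3+2\varphi a^4x^2+2^{1/2}a^5x$, with $a\neq 0$ and $\varphi=\pm(1-2^{1/2})$; \item $x^6+ax^5+2a^3x^3+a^4x^2+(2+2^{1/2})a^5x$, with $a\neq 0$; \end{itemize} where $a$ ranges over $\mathbb{F}_{3^2}$.
   Context: A polynomial $f\in\mathbb{F}_q[x]$ is a permutation polynomial of $\mathbb{F}_q$ if $c\mapsto f(c)$ is a permutation of $\mathbb{F}_q$. The symbol $2^{1/2}$ stands for either solution of $x^2-2=0$ in $\mathbb{F}_{3^2}$: both choices are allowed, but within any single polynomial all occurrences of $2^{1/2}$ (including the one in $\varphi$) denote the same solution. *)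

theory Defs
  imports "HOL-Computational_Algebra.Polynomial" "HOL-Library.Cardinality"
begin

definition permutation_poly :: "'a :: {field, finite} poly \<Rightarrow> bool" where
  "permutation_poly f \<longleftrightarrow> bij (poly f)"

end

theory Submission
  imports Defs "HOL-Computational_Algebra.Primes"
begin

text \<open>
  Substituting \<open>a x\<close> for \<open>x\<close> and dividing by \<open>a\<^sup>6\<close> reduces the problem to \<open>a\<^sub>5 = 1\<close>. The field with
  nine elements is generated over its prime field by a square root \<open>i\<close> of \<open>-1 = 2\<close>. Encoding
  \<open>a + b i\<close> as the integer pair \<open>(a, b)\<close> modulo 3, the remaining \<open>9\<^sup>3\<close> coefficient triples are decided
  by tabulating the values of the corresponding sextics.
\<close>

section \<open>Characteristic, prime field and a square root of -1\<close>

text \<open>The shift by 1 permutes the field, so it preserves the sum of all elements; comparing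
  both sums gives 9 = 0, hence 3 = 0 since a field has no nilpotents.\<close>

lemma CHAR_eq_3:
  assumes "CARD('a :: {field, finite}) = 3 ^ 2"
  shows "CHAR('a) = 3"
proof -
  have "(\<Sum>x\<in>UNIV. x :: 'a) = (\<Sum>x\<in>UNIV. x + 1)"
    by (rule sum.reindex_bij_witness[of _ "\<lambda>x. x + 1" "\<lambda>x. x - 1"]) auto
  hence "of_nat (3 ^ 2) = (0 :: 'a)"
    by (simp add: sum.distrib assms)
  hence "of_nat 3 = (0 :: 'a)"
    by (metis of_nat_power power_not_zero)
  hence "CHAR('a) dvd 3"
    by (simp only: of_nat_eq_0_iff_char_dvd)
  moreover have "prime (3 :: nat)"
    by simp
  ultimately show ?thesis
    using CHAR_not_1[where 'a = 'a] by (metis One_nat_def prime_nat_iff)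
qed

context
  assumes char: "CHAR('a :: {field, finite}) = 3"
begin

lemma of_int_eq_0_iff: "of_int n = (0 :: 'a) \<longleftrightarrow> 3 dvd n"
  using of_int_eq_0_iff_char_dvd[where 'a = 'a, of n] char by simp

lemma of_int_eq_iff_mod: "of_int m = (of_int n :: 'a) \<longleftrightarrow> m mod 3 = n mod 3"
  using of_int_eq_0_iff[of "m - n"] by (simp add: mod_eq_dvd_iff)

lemma two_eq_minus_one: "(2 :: 'a) = -1"
  using of_int_eq_iff_mod[of 2 "-1"] by simp

lemma range_of_int_eq: "range of_int = {0, 1, 2 :: 'a}"
proof -
  have "(of_int n :: 'a) \<in> {0, 1, 2}" for n
  proof -
    have "n mod 3 \<in> {0, 1, 2}"
      by auto
    moreover have "(of_int n :: 'a) = of_int (n mod 3)"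
      by (subst of_int_eq_iff_mod) simp
    moreover have "of_int k \<in> {0, 1, 2 :: 'a}" if "k \<in> {0, 1, 2}" for k
      using that by auto
    ultimately show ?thesis
      by metis
  qed
  hence "range of_int \<subseteq> {0, 1, 2 :: 'a}"
    by (rule image_subsetI)
  moreover have "{0, 1, 2 :: 'a} = of_int ` {0, 1, 2}"
    by simp
  hence "{0, 1, 2 :: 'a} \<subseteq> range of_int"
    by (metis image_mono subset_UNIV)
  ultimately show ?thesis
    by (rule subset_antisym)
qed

text \<open>This is linear independence of 1 and \<open>t\<close> over the prime field. A nonzero
  residue modulo 3 is its own inverse, so a nonzero difference \<open>k\<close> of the
  \<open>t\<close>-coefficients could be divided out, which would put \<open>t\<close> into the
  prime field.\<close>

lemma of_int_add_mult_eq_iff: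
  assumes "t \<notin> range of_int"
  shows "of_int a + of_int b * t = of_int c + of_int d * (t :: 'a)
           \<longleftrightarrow> a mod 3 = c mod 3 \<and> b mod 3 = d mod 3"
proof
  assume eq: "of_int a + of_int b * t = of_int c + of_int d * t"
  define k where "k = b - d"
  have k: "of_int k * t = of_int (c - a)"
    using eq by (simp add: k_def algebra_simps)
  have "3 dvd k"
  proof (rule ccontr)
    assume "\<not> 3 dvd k"
    hence "k mod 3 = 1 \<or> k mod 3 = 2"
      by presburger
    hence "(k * k) mod 3 = 1 mod 3"
      by (auto simp: mod_mult_eq[of k 3 k, symmetric])
    hence "(of_int (k * k) :: 'a) = of_int 1"
      by (subst of_int_eq_iff_mod)
    hence "t = of_int (k * (c - a))"
      using k by (metis mult.assoc mult_1 of_int_1 of_int_mult)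
    thus False
      using assms by blast
  qed
  hence b: "b mod 3 = d mod 3"
    by (simp add: k_def mod_eq_dvd_iff)
  hence "(of_int b :: 'a) = of_int d"
    by (simp add: of_int_eq_iff_mod)
  with eq show "a mod 3 = c mod 3 \<and> b mod 3 = d mod 3"
    using b by (simp add: of_int_eq_iff_mod)
next
  assume "a mod 3 = c mod 3 \<and> b mod 3 = d mod 3"
  hence "(of_int a :: 'a) = of_int c" "(of_int b :: 'a) = of_int d"
    by (simp_all add: of_int_eq_iff_mod)
  thus "of_int a + of_int b * t = of_int c + of_int d * t"
    by simp
qed

text \<open>By independence the nine coefficient pairs have nine different values, as many as there
  are field elements.\<close>

lemma surj_of_int_add_mult:
  assumes "CARD('a) = 3 ^ 2" "t \<notin> range of_int"
  shows "(\<lambda>(a, b). of_int a + of_int b * t :: 'a) ` ({0, 1, 2} \<times> {0, 1, 2}) = UNIV"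
proof (rule card_subset_eq)
  have "inj_on (\<lambda>(a, b). of_int a + of_int b * t) ({0, 1, 2} \<times> {0, 1, 2})"
  proof (rule inj_onI, clarify)
    fix a b c d :: int
    assume "a \<in> {0, 1, 2}" "b \<in> {0, 1, 2}" "c \<in> {0, 1, 2}" "d \<in> {0, 1, 2}"
    moreover assume "of_int a + of_int b * t = of_int c + of_int d * t"
    hence "a mod 3 = c mod 3 \<and> b mod 3 = d mod 3"
      unfolding of_int_add_mult_eq_iff[OF assms(2)] .
    ultimately show "a = c \<and> b = d"
      by auto
  qed
  thus "card ((\<lambda>(a, b). of_int a + of_int b * t) ` ({0, 1, 2} \<times> {0, 1, 2})) = CARD('a)"
    by (simp add: card_image card_cartesian_product assms(1))
qed auto

text \<open>Any \<open>t\<close> outside the prime field satisfies a quadratic equation over it, and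
  a translate \<open>u\<close> of \<open>t\<close> has its square in the prime field. The squares 0
  and 1 would force \<open>u\<close> to be 0, 1 or -1, so only 2 = -1 remains.\<close>

lemma exists_sqrt_minus_one:
  assumes "CARD('a) = 3 ^ 2"
  shows "\<exists>i :: 'a. i * i = -1"
proof -
  have "card {0, 1, 2 :: 'a} \<le> 3"
    by (rule card_insert_le_m1) (auto intro: card_insert_le_m1)
  hence "range of_int \<noteq> (UNIV :: 'a set)"
    using assms unfolding range_of_int_eq by auto
  then obtain t :: 'a where t: "t \<notin> range of_int"
    by blast
  obtain c d where cd: "t * t = of_int c + of_int d * t"
    using surj_of_int_add_mult[OF assms t] by (metis (no_types, lifting) UNIV_I case_prod_beta imageE)
  define u where "u = t + of_int d"
  have u: "u \<notin> range of_int"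
  proof
    assume "u \<in> range of_int"
    then obtain n where "u = of_int n"
      by blast
    hence "t = of_int (n - d)"
      by (simp add: u_def algebra_simps)
    thus False
      using t by blast
  qed
  \<comment> \<open>completing the square: \<open>d = -d / 2\<close> in characteristic 3\<close>
  have "u * u = of_int (c + d * d) + of_int (3 * d) * t"
    using cd by (simp add: u_def algebra_simps)
  moreover have "of_int (3 * d) = (0 :: 'a)"
    by (subst of_int_eq_0_iff) simp
  ultimately have "u * u = of_int (c + d * d)"
    by simp
  hence "u * u \<in> range of_int"
    by (rule range_eqI)
  hence "u * u = 0 \<or> u * u = 1 \<or> u * u = 2"
    unfolding range_of_int_eq by simp
  moreover have "u \<noteq> 0" "u \<noteq> 1" "u \<noteq> -1"
    using u unfolding range_of_int_eq two_eq_minus_one by auto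
  ultimately have "u * u = -1"
    by (auto simp: two_eq_minus_one square_eq_1_iff)
  thus ?thesis ..
qed

end

section \<open>Computable model on integer pairs modulo 3\<close>

definition add3 :: "int \<times> int \<Rightarrow> int \<times> int \<Rightarrow> int \<times> int" where
  "add3 = (\<lambda>(a, b) (c, d). ((a + c) mod 3, (b + d) mod 3))"

definition mul3 :: "int \<times> int \<Rightarrow> int \<times> int \<Rightarrow> int \<times> int" where
  "mul3 = (\<lambda>(a, b) (c, d). ((a * c - b * d) mod 3, (a * d + b * c) mod 3))"

definition pairs3 :: "(int \<times> int) list" where
  "pairs3 = List.product [0, 1, 2] [0, 1, 2]"

text \<open>Here \<open>b\<close>, \<open>c\<close>, \<open>d\<close> are the coefficients of x^3,
  x^2 and x; the two leading terms are computed as x^3 (x^3 + x^2), so that only the square and the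
  cube of x are needed.\<close>

definition sextic3 :: "int \<times> int \<Rightarrow> int \<times> int \<Rightarrow> int \<times> int \<Rightarrow> int \<times> int \<Rightarrow> int \<times> int" where
  "sextic3 b c d x =
     (let y = mul3 x x; z = mul3 x y
      in add3 (mul3 z (add3 z y)) (add3 (mul3 b z) (add3 (mul3 c y) (mul3 d x))))"

text \<open>Exhaustive evaluation. The first triple belongs to the first family, the next two to the
  third family (one per square root of 2), and the last four to the second family (two square roots,
  two signs of \<phi>).\<close>

lemma distinct_sextic3_iff:
  "\<forall>b \<in> set pairs3. \<forall>c \<in> set pairs3. \<forall>d \<in> set pairs3.
     distinct (map (sextic3 b c d) pairs3) \<longleftrightarrow>
     (b, c, d) \<in> set [((1, 0), (2, 0), (2, 0)), ((2, 0), (1, 0), (2, 1)), ((2, 0), (1, 0), (2, 2)),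
       ((1, 1), (2, 2), (0, 2)), ((2, 2), (1, 1), (0, 2)),
       ((1, 2), (2, 1), (0, 1)), ((2, 1), (1, 2), (0, 1))]"
  by code_simp

lemma set_pairs3: "set pairs3 = {0, 1, 2} \<times> {0, 1, 2}"
  by (simp add: pairs3_def)

lemma distinct_pairs3: "distinct pairs3"
  by (simp add: pairs3_def)

lemma mod_3_mem: "n mod 3 \<in> {0, 1, 2 :: int}"
  by auto

lemma add3_in_pairs3: "add3 p q \<in> set pairs3"
  unfolding add3_def set_pairs3 case_prod_beta by (intro SigmaI mod_3_mem)

lemma sextic3_in_pairs3: "sextic3 b c d x \<in> set pairs3"
  by (simp add: sextic3_def Let_def add3_in_pairs3)

section \<open>Transfer from the pairs to the field\<close>

locale field_9 =
  fixes i :: "'a :: {field, finite}"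
  assumes card: "CARD('a) = 3 ^ 2" and i_sq: "i * i = -1"
begin

definition e :: "int \<times> int \<Rightarrow> 'a" where
  "e = (\<lambda>(a, b). of_int a + of_int b * i)"

lemmas char = CHAR_eq_3[OF card]

lemma i_notin_range: "i \<notin> range of_int"
proof
  assume "i \<in> range of_int"
  hence "i = 0 \<or> i = 1 \<or> i = -1"
    by (auto simp: range_of_int_eq[OF char] two_eq_minus_one[OF char])
  hence "i * i = 0 \<or> i * i = 1"
    by auto
  hence "(2 :: 'a) = 1"
    using two_eq_minus_one[OF char] i_sq by auto
  thus False
    using one_add_one by (metis add_cancel_right_right one_neq_zero)
qed

lemma e_image: "e ` set pairs3 = UNIV"
  unfolding e_def set_pairs3 by (rule surj_of_int_add_mult[OF char card i_notin_range])

lemma e_eq_iff: "e (a, b) = e (c, d) \<longleftrightarrow> a mod 3 = c mod 3 \<and> b mod 3 = d mod 3"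
  unfolding e_def prod.case by (rule of_int_add_mult_eq_iff[OF char i_notin_range])

lemma inj_on_e: "inj_on e (set pairs3)"
proof (rule eq_card_imp_inj_on)
  show "card (e ` set pairs3) = card (set pairs3)"
    unfolding e_image card by (simp add: set_pairs3 card_cartesian_product)
qed simp

lemma e_mod: "e (a mod 3, b mod 3) = e (a, b)"
  by (simp add: e_eq_iff)

lemma e_add3: "e (add3 p q) = e p + e q"
  by (simp add: add3_def e_mod split: prod.split) (simp add: e_def algebra_simps)

lemma e_mul3: "e (mul3 p q) = e p * e q"
proof -
  obtain a b c d where pq: "p = (a, b)" "q = (c, d)"
    by fastforce
  \<comment> \<open>The only discrepancy between the product in the field and the pair formula is a
    multiple of \<open>i * i + 1\<close>, which vanishes.\<close>
  have "e p * e q = e (a * c - b * d, a * d + b * c) + of_int (b * d) * (i * i + 1)"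
    by (simp add: pq e_def algebra_simps)
  thus ?thesis
    by (simp add: pq mul3_def e_mod i_sq)
qed

lemma e_sextic3:
  "e (sextic3 b c d x) = e x ^ 6 + e x ^ 5 + e b * e x ^ 3 + e c * e x ^ 2 + e d * e x"
  by (simp add: sextic3_def Let_def e_add3 e_mul3 eval_nat_numeral algebra_simps)

text \<open>\<open>e\<close> is a bijection from the nine representatives onto the field and
  intertwines \<open>sextic3\<close> with the polynomial map; as \<open>sextic3\<close> stays within
  the representatives, injectivity carries over in both directions.\<close>

lemma inj_iff_distinct_sextic3:
  "inj (\<lambda>x. x ^ 6 + x ^ 5 + e b * x ^ 3 + e c * x ^ 2 + e d * x)
     \<longleftrightarrow> distinct (map (sextic3 b c d) pairs3)"
  (is "inj ?f \<longleftrightarrow> _")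
proof -
  have "inj ?f \<longleftrightarrow> inj_on (?f \<circ> e) (set pairs3)"
    using comp_inj_on_iff[OF inj_on_e, of ?f] by (simp add: e_image)
  also have "?f \<circ> e = e \<circ> sextic3 b c d"
    by (simp add: fun_eq_iff e_sextic3)
  also have "inj_on (e \<circ> sextic3 b c d) (set pairs3) \<longleftrightarrow> inj_on (sextic3 b c d) (set pairs3)"
    using inj_on_e sextic3_in_pairs3
    by (meson comp_inj_on image_subsetI inj_on_imageI2 inj_on_subset)
  also have "\<dots> \<longleftrightarrow> distinct (map (sextic3 b c d) pairs3)"
    by (simp add: distinct_map distinct_pairs3)
  finally show ?thesis .
qed

text \<open>Since 2 = -1, the choices of the square root of 2 are exactly \<open>i\<close> and
  \<open>- i\<close>.\<close>

lemma sqrt_2_iff: "s ^ 2 - 2 = 0 \<longleftrightarrow> s = i \<or> s = - i"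
proof -
  have "s ^ 2 - 2 = (s - i) * (s + i)"
    by (simp add: algebra_simps power2_eq_square i_sq two_eq_minus_one[OF char])
  thus ?thesis
    by (simp add: eq_neg_iff_add_eq_0)
qed

lemma inj_sextic_iff:
  "inj (\<lambda>x :: 'a. x ^ 6 + x ^ 5 + b * x ^ 3 + c * x ^ 2 + d * x) \<longleftrightarrow>
     b = 1 \<and> c = 2 \<and> d = 2 \<or>
     (\<exists>s \<phi>. s ^ 2 - 2 = 0 \<and> (\<phi> = 1 - s \<or> \<phi> = - (1 - s)) \<and> b = \<phi> \<and> c = 2 * \<phi> \<and> d = s) \<or>
     (\<exists>s. s ^ 2 - 2 = 0 \<and> b = 2 \<and> c = 1 \<and> d = 2 + s)"
proof -
  have ex: "\<exists>p. x = e p \<and> p \<in> set pairs3" for x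
    using e_image by (metis imageE UNIV_I)
  obtain b' c' d' where bcd: "b = e b'" "c = e c'" "d = e d'"
    and in_pairs: "b' \<in> set pairs3" "c' \<in> set pairs3" "d' \<in> set pairs3"
    using ex[of b] ex[of c] ex[of d] by blast
  \<comment> \<open>Injectivity of \<open>e\<close> turns membership of the pair triple in the table
    into equations between field elements.\<close>
  have e_iff: "b' = p \<longleftrightarrow> b = e p" "c' = p \<longleftrightarrow> c = e p" "d' = p \<longleftrightarrow> d = e p"
    if "p \<in> set pairs3" for p
    using that in_pairs inj_on_e unfolding bcd by (simp_all add: inj_on_eq_iff)
  have e_simps: "e (1, 0) = 1" "e (2, 0) = -1" "e (0, 1) = i" "e (0, 2) = - i" "e (1, 1) = 1 + i"
    "e (1, 2) = 1 - i" "e (2, 1) = i - 1" "e (2, 2) = - i - 1"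
    by (simp_all add: e_def two_eq_minus_one[OF char])
  have "inj (\<lambda>x. x ^ 6 + x ^ 5 + b * x ^ 3 + c * x ^ 2 + d * x) \<longleftrightarrow>
      (b, c, d) \<in> {(1, -1, -1), (-1, 1, i - 1), (-1, 1, - i - 1),
        (1 + i, - i - 1, - i), (- i - 1, 1 + i, - i), (1 - i, i - 1, i), (i - 1, 1 - i, i)}"
    unfolding bcd inj_iff_distinct_sextic3
    unfolding distinct_sextic3_iff[rule_format, OF in_pairs]
    by (simp add: e_iff set_pairs3 e_simps flip: bcd)
  moreover have "(\<exists>s \<phi>. s ^ 2 - 2 = 0 \<and> (\<phi> = 1 - s \<or> \<phi> = - (1 - s)) \<and> b = \<phi> \<and> c = 2 * \<phi> \<and> d = s) \<longleftrightarrow>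
      (\<exists>s \<in> {i, - i}. \<exists>\<phi> \<in> {1 - s, - (1 - s)}. b = \<phi> \<and> c = 2 * \<phi> \<and> d = s)"
    unfolding sqrt_2_iff by blast
  moreover have "(\<exists>s. s ^ 2 - 2 = 0 \<and> b = 2 \<and> c = 1 \<and> d = 2 + s) \<longleftrightarrow>
      (\<exists>s \<in> {i, - i}. b = 2 \<and> c = 1 \<and> d = 2 + s)"
    unfolding sqrt_2_iff by blast
  \<comment> \<open>With \<open>s\<close> and \<open>\<phi>\<close> each ranging over two explicit
    values, the families unfold to the seven tabulated triples once 2 is written as -1.\<close>
  ultimately show ?thesis
    by (simp only: two_eq_minus_one[OF char])
      (simp add: conj_disj_distribL conj_disj_distribR disj_ac cong: conj_cong)
qed

end

section \<open>Normalization of the x^5 coefficient and conclusion\<close>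

text \<open>The coefficient of x^k carries the factor a^(6-k), so each term contributes a^6 after
  the substitution.\<close>

lemma poly_scaled_sextic:
  fixes a :: "'a :: comm_ring_1"
  shows "poly (monom 1 6 + monom a 5 + monom (b * a ^ 3) 3 + monom (c * a ^ 4) 2 + monom (d * a ^ 5) 1) (a * x)
           = a ^ 6 * (x ^ 6 + x ^ 5 + b * x ^ 3 + c * x ^ 2 + d * x)"
  by (simp add: poly_monom algebra_simps eval_nat_numeral)

text \<open>Multiplication by \<open>a\<close> before and by \<open>a ^ 6\<close> after the map are
  bijections, and on a finite set injectivity suffices.\<close>

lemma permutation_poly_scaled_sextic_iff:
  fixes a :: "'a :: {field, finite}"
  assumes "a \<noteq> 0"
  shows "permutation_poly (monom 1 6 + monom a 5 + monom (b * a ^ 3) 3 + monom (c * a ^ 4) 2 + monom (d * a ^ 5) 1)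
           \<longleftrightarrow> inj (\<lambda>x. x ^ 6 + x ^ 5 + b * x ^ 3 + c * x ^ 2 + d * x)"
  (is "permutation_poly ?f \<longleftrightarrow> inj ?g")
proof -
  have bij: "bij ((*) c)" if "c \<noteq> 0" for c :: 'a
    using that by (intro bij_betw_byWitness[where f' = "\<lambda>x. x / c"]) auto
  have "permutation_poly ?f \<longleftrightarrow> bij (poly ?f \<circ> (*) a)"
    unfolding permutation_poly_def by (rule bij_betw_comp_iff[OF bij[OF assms]])
  also have "poly ?f \<circ> (*) a = (*) (a ^ 6) \<circ> ?g"
    by (rule ext) (simp only: o_apply poly_scaled_sextic)
  also have "bij ((*) (a ^ 6) \<circ> ?g) \<longleftrightarrow> bij ?g"
    by (rule bij_betw_comp_iff2[OF bij, symmetric]) (use assms in auto)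
  also have "bij ?g \<longleftrightarrow> inj ?g"
    using finite_UNIV_inj_surj[of ?g] by (auto simp: bij_def)
  finally show ?thesis .
qed

theorem theorem3p12:
  assumes "CARD('a :: {field, finite}) = 3 ^ 2"
  shows
    "{f :: 'a poly.
        (\<exists>a1 a2 a3 a5. a5 \<noteq> 0 \<and>
           f = monom 1 6 + monom a5 5 + monom a3 3 + monom a2 2 + monom a1 1) \<and>
        permutation_poly f} =
     {monom 1 6 + monom a 5 + monom (a ^ 3) 3 + monom (2 * a ^ 4) 2 + monom (2 * a ^ 5) 1
        | a. a \<noteq> 0} \<union>
     {monom 1 6 + monom a 5 + monom (\<phi> * a ^ 3) 3 + monom (2 * \<phi> * a ^ 4) 2 + monom (s * a ^ 5) 1
        | a s \<phi>. a \<noteq> 0 \<and> s ^ 2 - 2 = 0 \<and> (\<phi> = 1 - s \<or> \<phi> = - (1 - s))} \<union>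
     {monom 1 6 + monom a 5 + monom (2 * a ^ 3) 3 + monom (a ^ 4) 2 + monom ((2 + s) * a ^ 5) 1
        | a s. a \<noteq> 0 \<and> s ^ 2 - 2 = 0}"
  (is "?L = ?A \<union> ?B \<union> ?C")
proof -
  obtain i :: 'a where "i * i = -1"
    using exists_sqrt_minus_one[OF CHAR_eq_3[OF assms] assms] by blast
  then interpret field_9 i
    by unfold_locales (rule assms)
  let ?f = "\<lambda>a b c d :: 'a. monom 1 6 + monom a 5 + monom (b * a ^ 3) 3 + monom (c * a ^ 4) 2 + monom (d * a ^ 5) 1"
  have "f \<in> ?L \<longleftrightarrow> (\<exists>a b c d. a \<noteq> 0 \<and> f = ?f a b c d \<and> permutation_poly (?f a b c d))" for f
  proof -
    have "(\<exists>a1 a2 a3. f = monom 1 6 + monom a 5 + monom a3 3 + monom a2 2 + monom a1 1)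
            \<longleftrightarrow> (\<exists>b c d. f = ?f a b c d)" if "a \<noteq> 0" for a
    proof
      assume "\<exists>a1 a2 a3. f = monom 1 6 + monom a 5 + monom a3 3 + monom a2 2 + monom a1 1"
      then obtain a1 a2 a3 where "f = monom 1 6 + monom a 5 + monom a3 3 + monom a2 2 + monom a1 1"
        by blast
      \<comment> \<open>Division by powers of the nonzero \<open>a\<close> brings arbitrary lower
        coefficients into scaled form.\<close>
      hence "f = ?f a (a3 / a ^ 3) (a2 / a ^ 4) (a1 / a ^ 5)"
        using that by simp
      thus "\<exists>b c d. f = ?f a b c d"
        by blast
    qed blast
    thus ?thesis
      unfolding mem_Collect_eq by metis
  qed
  \<comment> \<open>The condition on the normalized coefficients does not involve \<open>a\<close>,
    so each admissible triple yields one polynomial for every nonzero \<open>a\<close>.\<close>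
  hence L: "f \<in> ?L \<longleftrightarrow> (\<exists>a b c d. a \<noteq> 0 \<and> f = ?f a b c d \<and>
      (b = 1 \<and> c = 2 \<and> d = 2 \<or>
       (\<exists>s \<phi>. s ^ 2 - 2 = 0 \<and> (\<phi> = 1 - s \<or> \<phi> = - (1 - s)) \<and> b = \<phi> \<and> c = 2 * \<phi> \<and> d = s) \<or>
       (\<exists>s. s ^ 2 - 2 = 0 \<and> b = 2 \<and> c = 1 \<and> d = 2 + s)))" for f
    by (simp only: permutation_poly_scaled_sextic_iff inj_sextic_iff not_False_eq_True
        cong: conj_cong)
  have A: "f \<in> ?A \<longleftrightarrow> (\<exists>a. a \<noteq> 0 \<and> f = ?f a 1 2 2)" for f
    unfolding mult_1 by blast
  have B: "f \<in> ?B \<longleftrightarrow> (\<exists>a s \<phi>. a \<noteq> 0 \<and> s ^ 2 - 2 = 0 \<and> (\<phi> = 1 - s \<or> \<phi> = - (1 - s)) \<and>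
      f = ?f a \<phi> (2 * \<phi>) s)" for f
    by blast
  have C: "f \<in> ?C \<longleftrightarrow> (\<exists>a s. a \<noteq> 0 \<and> s ^ 2 - 2 = 0 \<and> f = ?f a 2 1 (2 + s))" for f
    unfolding mult_1 by blast
  show ?thesis
    by (rule set_eqI, unfold Un_iff L A B C) blast
qed

end
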